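(* Let $G=(V,E,w)$ be a finite vertex-weighted graph with nonnegative vertex weights and maximum degree $\Delta$. For any $\varepsilon\in(0,0.01]$, if $k\ge\frac{\Delta+1}{\varepsilon}$ is an integer and $\max_{v\in V}w_v\le\frac{\varepsilon^2 w(V)}{k^2\ln k}$, then there exists a $(1+25\varepsilon)$-EQ1 $k$-coloring of $G$.
   Context: For $S\subseteq V$, $w(S)=\sum_{v\in S}w_v$. A $k$-coloring of $G$ is a partition $(C_1,\dots,C_k)$ of $V$ into $k$ (possibly empty) sets, each of which is an independent set of $G$. For $\alpha\ge 1$, a coloring $(C_1,\dots,C_k)$ is $\alpha$-EQ1 if for every $i,j\in[k]$ with $C_i\neq\emptyset$ there exists a vertex $\bar v\in C_i$ such that $w(C_i\setminus\{\bar v\})\le \alpha\, w(C_j)$. *)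

theory Defs
  imports "HOL-Analysis.Analysis" "HOL-Library.Disjoint_Sets"
begin

definition fin_simple_graph :: "'a set \<Rightarrow> 'a set set \<Rightarrow> bool" where
  "fin_simple_graph V E \<longleftrightarrow> finite V \<and> (\<forall>e\<in>E. e \<subseteq> V \<and> card e = 2)"

definition vertex_degree :: "'a set set \<Rightarrow> 'a \<Rightarrow> nat" where
  "vertex_degree E v = card {e \<in> E. v \<in> e}"

text \<open>Inserting \<open>0\<close> only matters for the graph without vertices, whose maximum degree is \<open>0\<close>.\<close>

definition max_degree :: "'a set \<Rightarrow> 'a set set \<Rightarrow> nat" where
  "max_degree V E = Max (insert 0 (vertex_degree E ` V))"

definition independent_set :: "'a set \<Rightarrow> 'a set set \<Rightarrow> 'a set \<Rightarrow> bool" where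
  "independent_set V E S \<longleftrightarrow> S \<subseteq> V \<and> (\<forall>u\<in>S. \<forall>v\<in>S. {u, v} \<notin> E)"

text \<open>The classes are indexed by \<open>1, \<dots>, k\<close> and may be empty, which rules out \<open>partition_on\<close>.\<close>

definition k_coloring :: "'a set \<Rightarrow> 'a set set \<Rightarrow> nat \<Rightarrow> (nat \<Rightarrow> 'a set) \<Rightarrow> bool" where
  "k_coloring V E k C \<longleftrightarrow>
     (\<Union>i\<in>{1..k}. C i) = V \<and> disjoint_family_on C {1..k} \<and>
     (\<forall>i\<in>{1..k}. independent_set V E (C i))"

definition EQ1 :: "('a \<Rightarrow> real) \<Rightarrow> real \<Rightarrow> nat \<Rightarrow> (nat \<Rightarrow> 'a set) \<Rightarrow> bool" where
  "EQ1 w \<alpha> k C \<longleftrightarrow>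
     (\<forall>i\<in>{1..k}. \<forall>j\<in>{1..k}. C i \<noteq> {} \<longrightarrow>
        (\<exists>v\<in>C i. sum w (C i - {v}) \<le> \<alpha> * sum w (C j)))"

end

theory Submission
  imports Defs
begin

text \<open>
  Colour the vertices greedily in order of decreasing weight, always using the lightest colour not
  occurring among the neighbours coloured so far. Let \<open>W\<close> be the total weight, \<open>d\<close> the maximum degree
  and \<open>M\<close> a bound on the vertex weights.
  When a vertex enters a class, at least \<open>k - d\<close> classes are at least as heavy as this one, so the
  class without its last vertex weighs at most \<open>W / (k - d)\<close>.
  Conversely, fix a colour \<open>c\<close> with final weight \<open>L\<close>. A vertex \<open>u\<close> of colour \<open>c\<close> blocks this colour for
  at most \<open>d\<close> later vertices, none heavier than \<open>u\<close>, so the vertices blocked from \<open>c\<close> weigh at most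
  \<open>d L\<close> in total. Every other vertex was put into a class of weight at most \<open>L\<close>, so these vertices
  contribute at most \<open>L + M\<close> to each class. Hence \<open>W \<le> (k + d) L + k M\<close>.
\<close>

section \<open>Colour classes and vertices blocked from a colour\<close>

definition color_class :: "'a set \<Rightarrow> ('a \<Rightarrow> nat) \<Rightarrow> nat \<Rightarrow> 'a set" where
  "color_class S f i = {v \<in> S. f v = i}"

text \<open>Comparing weights replaces the order of insertion: a vertex blocked from \<open>c\<close> when the greedy
  procedure reaches it has a neighbour of colour \<open>c\<close> that is at least as heavy.\<close>

definition blocked :: "'a set set \<Rightarrow> ('a \<Rightarrow> real) \<Rightarrow> 'a set \<Rightarrow> 'a \<Rightarrow> bool" where
  "blocked E w A v \<longleftrightarrow> (\<exists>u\<in>A. {u, v} \<in> E \<and> w v \<le> w u)"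

lemma card_neighbours_le:
  assumes "fin_simple_graph V E"
  shows "finite {v. {u, v} \<in> E}" "card {v. {u, v} \<in> E} \<le> vertex_degree E u"
proof -
  have "E \<subseteq> Pow V" "finite V"
    using assms by (auto simp: fin_simple_graph_def)
  then have fin: "finite {e \<in> E. u \<in> e}"
    by (simp add: finite_subset)
  have inj: "inj_on (\<lambda>v. {u, v}) {v. {u, v} \<in> E}"
    by (auto simp: inj_on_def doubleton_eq_iff)
  have sub: "(\<lambda>v. {u, v}) ` {v. {u, v} \<in> E} \<subseteq> {e \<in> E. u \<in> e}"
    by auto
  show "finite {v. {u, v} \<in> E}"
    using finite_imageD[OF finite_subset[OF sub fin] inj] .
  show "card {v. {u, v} \<in> E} \<le> vertex_degree E u"
    unfolding vertex_degree_def by (rule card_inj_on_le[OF inj sub fin])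
qed

text \<open>Each blocked vertex is charged to a neighbour in \<open>A\<close> that is at least as
  heavy. A vertex \<open>u\<close> receives at most \<open>d\<close> charges of at most
  \<open>w u\<close> each, and double charging only enlarges the bound.\<close>

lemma sum_blocked_le:
  fixes w :: "'a \<Rightarrow> real"
  assumes G: "fin_simple_graph V E"
    and nonneg: "\<And>v. v \<in> V \<Longrightarrow> 0 \<le> w v"
    and deg: "\<And>v. v \<in> V \<Longrightarrow> vertex_degree E v \<le> d"
    and A: "A \<subseteq> V"
  shows "sum w {v \<in> V. blocked E w A v} \<le> real d * sum w A"
proof -
  define B where "B u = {v \<in> V. {u, v} \<in> E \<and> w v \<le> w u}" for u
  have finV: "finite V"
    using G by (simp add: fin_simple_graph_def)
  then have finA: "finite A" and finB: "finite (B u)" for u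
    using A by (auto simp: B_def finite_subset)
  have "sum w {v \<in> V. blocked E w A v} = sum w (\<Union>u\<in>A. B u)"
    by (rule sum.cong) (auto simp: blocked_def B_def)
  also have "\<dots> \<le> (\<Sum>u\<in>A. sum w (B u))"
    using finA
  proof (induction A rule: finite_induct)
    case (insert u A)
    have "0 \<le> sum w (B u \<inter> (\<Union>u\<in>A. B u))"
      by (rule sum_nonneg) (auto simp: B_def nonneg)
    then show ?case
      using insert finB by (simp add: sum_Un)
  qed simp
  also have "\<dots> \<le> (\<Sum>u\<in>A. real d * w u)"
  proof (rule sum_mono)
    fix u assume "u \<in> A"
    then have u: "u \<in> V" using A by blast
    have "card (B u) \<le> card {v. {u, v} \<in> E}"
      by (rule card_mono[OF card_neighbours_le(1)[OF G]]) (auto simp: B_def)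
    then have "card (B u) \<le> d"
      using card_neighbours_le(2)[OF G, of u] deg[OF u] by linarith
    have "sum w (B u) \<le> real (card (B u)) * w u"
      by (rule sum_bounded_above) (simp add: B_def)
    also have "\<dots> \<le> real d * w u"
      using \<open>card (B u) \<le> d\<close> nonneg[OF u] by (simp add: mult_right_mono)
    finally show "sum w (B u) \<le> real d * w u" .
  qed
  finally show ?thesis
    by (simp add: sum_distrib_left)
qed

section \<open>The greedy colouring and its invariants\<close>

lemma sum_color_class:
  fixes w :: "'a \<Rightarrow> real"
  assumes "finite S" "f ` S \<subseteq> {1..k}"
  shows "(\<Sum>i\<in>{1..k}. sum w (color_class S f i)) = sum w S"
  unfolding color_class_def using assms by (intro sum.group) auto

text \<open>Averaging: at least \<open>k - d\<close> classes are free, and each weighs at least as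
  much as the lightest of them.\<close>

lemma exists_lightest_free_color:
  fixes w :: "'a \<Rightarrow> real"
  assumes S: "finite S" "f ` S \<subseteq> {1..k}"
    and nonneg: "\<And>v. v \<in> S \<Longrightarrow> 0 \<le> w v"
    and F: "finite F" "card F \<le> d" "d < k"
  obtains a where "a \<in> {1..k} - F"
    "\<And>c. c \<in> {1..k} - F \<Longrightarrow> sum w (color_class S f a) \<le> sum w (color_class S f c)"
    "(real k - real d) * sum w (color_class S f a) \<le> sum w S"
proof -
  define L where "L c = sum w (color_class S f c)" for c
  define P where "P = {1..k} - F"
  have L0: "0 \<le> L c" for c
    unfolding L_def by (rule sum_nonneg) (auto simp: color_class_def nonneg)
  have "k - d \<le> card P"
    using diff_card_le_card_Diff[OF F(1), of "{1..k}"] F(2) by (simp add: P_def)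
  then have card: "real k - real d \<le> real (card P)" and "P \<noteq> {}"
    using F(3) by auto
  then obtain a where a: "a \<in> P" "\<And>c. c \<in> P \<Longrightarrow> L a \<le> L c"
    using ex_min_if_finite[of "L ` P"] by (fastforce simp: P_def not_less)
  have "(real k - real d) * L a \<le> real (card P) * L a"
    using card L0 by (rule mult_right_mono)
  also have "\<dots> \<le> sum L P"
    using sum_bounded_below[of P "L a" L] a(2) by simp
  also have "\<dots> \<le> sum L {1..k}"
    by (rule sum_mono2) (auto simp: P_def L0)
  also have "\<dots> = sum w S"
    unfolding L_def by (rule sum_color_class[OF S])
  finally show thesis
    using a by (intro that) (auto simp: P_def L_def)
qed

text \<open>The last conjunct uses the current weight of class \<open>c\<close> where the informal
  argument uses the final one. This makes it an invariant: classes only grow, so both the set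
  blocked from \<open>c\<close> and the right-hand side can only increase.\<close>

lemma greedy_coloring:
  fixes w :: "'a \<Rightarrow> real"
  assumes G: "fin_simple_graph V E"
    and nonneg: "\<And>v. v \<in> V \<Longrightarrow> 0 \<le> w v"
    and bound: "\<And>v. v \<in> V \<Longrightarrow> w v \<le> M" and "0 \<le> M"
    and deg: "\<And>v. v \<in> V \<Longrightarrow> vertex_degree E v \<le> d" and "d < k"
    and "finite S" "S \<subseteq> V"
  shows "\<exists>f. f ` S \<subseteq> {1..k} \<and> (\<forall>u\<in>S. \<forall>v\<in>S. {u, v} \<in> E \<longrightarrow> f u \<noteq> f v) \<and>
    (\<forall>i. color_class S f i \<noteq> {} \<longrightarrow>
      (\<exists>v\<in>color_class S f i. (real k - real d) * sum w (color_class S f i - {v}) \<le> sum w S)) \<and>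
    (\<forall>c\<in>{1..k}. \<forall>i\<in>{1..k}.
      sum w {v \<in> color_class S f i. \<not> blocked E w (color_class S f c) v}
        \<le> sum w (color_class S f c) + M)"
  using \<open>finite S\<close> \<open>S \<subseteq> V\<close>
\<comment> \<open>Ranking by \<open>- w\<close> makes the inserted vertex a lightest one so far. The
  rule does not exclude that it already lies in \<open>S\<close>, hence the case distinction
  below.\<close>
proof (induction S rule: finite_ranking_induct[where f = "\<lambda>v. - w v"])
  case empty
  show ?case using \<open>0 \<le> M\<close> by (auto simp: color_class_def)
next
  case (insert x S)
  show ?case
  proof (cases "x \<in> S")
    case True
    then show ?thesis using insert by (simp add: insert_absorb)
  next
    case xS: False
    have xV: "x \<in> V" and SV: "S \<subseteq> V" and finS: "finite S"
      using insert by auto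
    have wx: "0 \<le> w x" "w x \<le> M" and lightest: "\<And>u. u \<in> S \<Longrightarrow> w x \<le> w u"
      using nonneg bound xV insert.hyps by auto
    from insert.IH[OF SV] obtain f where f: "f ` S \<subseteq> {1..k}"
      and proper: "\<And>u v. u \<in> S \<Longrightarrow> v \<in> S \<Longrightarrow> {u, v} \<in> E \<Longrightarrow> f u \<noteq> f v"
      and upper: "\<And>i. color_class S f i \<noteq> {} \<Longrightarrow>
        \<exists>v\<in>color_class S f i. (real k - real d) * sum w (color_class S f i - {v}) \<le> sum w S"
      and lower: "\<And>c i. c \<in> {1..k} \<Longrightarrow> i \<in> {1..k} \<Longrightarrow>
        sum w {v \<in> color_class S f i. \<not> blocked E w (color_class S f c) v}
          \<le> sum w (color_class S f c) + M"
      by blast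
    define F where "F = f ` {u \<in> S. {x, u} \<in> E}"
    have fin_nbr: "finite {u. {x, u} \<in> E}"
      by (rule card_neighbours_le(1)[OF G])
    have "finite F"
      using finS by (simp add: F_def)
    moreover have "card F \<le> d"
    proof -
      have "card F \<le> card {u \<in> S. {x, u} \<in> E}"
        unfolding F_def using finS by (intro card_image_le) simp
      also have "\<dots> \<le> card {u. {x, u} \<in> E}"
        using fin_nbr by (intro card_mono) auto
      finally show ?thesis
        using card_neighbours_le(2)[OF G, of x] deg[OF xV] by linarith
    qed
    ultimately obtain a where a: "a \<in> {1..k} - F"
      and a_min: "\<And>c. c \<in> {1..k} - F \<Longrightarrow>
        sum w (color_class S f a) \<le> sum w (color_class S f c)"
      and a_le: "(real k - real d) * sum w (color_class S f a) \<le> sum w S"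
      using exists_lightest_free_color[OF finS f, of w F d] nonneg SV \<open>d < k\<close> by blast
    define g where "g = f(x := a)"
    define T where "T = insert x S"
    have class_a: "color_class T g a = insert x (color_class S f a)"
      and class_other: "\<And>i. i \<noteq> a \<Longrightarrow> color_class T g i = color_class S f i"
      and x_notin: "\<And>i. x \<notin> color_class S f i"
      using xS by (auto simp: color_class_def g_def T_def)
    have fin_class: "\<And>i. finite (color_class S f i)"
      using finS by (simp add: color_class_def)
    have sum_a: "sum w (color_class T g a) = w x + sum w (color_class S f a)"
      using class_a x_notin fin_class by simp
    have sum_T: "sum w T = w x + sum w S"
      using xS finS by (simp add: T_def)
    have class_nonneg: "\<And>i v. v \<in> color_class S f i \<Longrightarrow> 0 \<le> w v"
      using nonneg SV by (auto simp: color_class_def)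
    have no_loop: "{x} \<notin> E"
      using G by (auto simp: fin_simple_graph_def)
    have nbr_x: "f u \<noteq> a" if "u \<in> S" "{x, u} \<in> E" for u
      using that a by (auto simp: F_def)
    show ?thesis unfolding T_def[symmetric]
    proof (intro exI[of _ g] conjI allI ballI impI)
      show "g ` T \<subseteq> {1..k}"
        using f a by (auto simp: g_def T_def)
    next
      fix u v assume "u \<in> T" "v \<in> T" "{u, v} \<in> E"
      then show "g u \<noteq> g v"
        using proper[of u v] nbr_x[of u] nbr_x[of v] no_loop xS
        by (auto simp: g_def T_def insert_commute)
    next
      fix i assume ne: "color_class T g i \<noteq> {}"
      show "\<exists>v\<in>color_class T g i.
        (real k - real d) * sum w (color_class T g i - {v}) \<le> sum w T"
      proof (cases "i = a")
        \<comment> \<open>The vertex to remove is \<open>x\<close>: what remains is the old class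
          \<open>a\<close>, bounded by \<open>a_le\<close>.\<close>
        case True
        then show ?thesis
          using class_a x_notin a_le sum_T wx by (intro bexI[of _ x]) auto
      next
        case False
        then show ?thesis
          using ne upper[of i] class_other[of i] sum_T wx by force
      qed
    next
      fix c i assume c: "c \<in> {1..k}" and i: "i \<in> {1..k}"
      define U where "U = {v \<in> color_class S f i. \<not> blocked E w (color_class S f c) v}"
      define U' where "U' = {v \<in> color_class T g i. \<not> blocked E w (color_class T g c) v}"
      have old: "sum w U \<le> sum w (color_class S f c) + M"
        unfolding U_def by (rule lower[OF c i])
      have mono: "sum w (color_class S f c) \<le> sum w (color_class T g c)"
        using sum_a wx class_other[of c] by (cases "c = a") auto
      have sub: "color_class S f c \<subseteq> color_class T g c"
        using class_a class_other[of c] by (cases "c = a") auto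
      show "sum w U' \<le> sum w (color_class T g c) + M"
      proof (cases "x \<in> U'")
        \<comment> \<open>Without \<open>x\<close>, every vertex of \<open>U'\<close> was already in
          class \<open>i\<close>, and a vertex not blocked by the larger class \<open>c\<close> was
          not blocked by the smaller one.\<close>
        case False
        then have "U' \<subseteq> U"
          using sub class_a class_other[of i]
          by (cases "i = a") (auto simp: U_def U'_def blocked_def)
        then have "sum w U' \<le> sum w U"
          using fin_class class_nonneg by (intro sum_mono2) (auto simp: U_def)
        then show ?thesis using old mono by linarith
      next
        \<comment> \<open>Here \<open>x\<close> has just joined class \<open>i = a\<close> and is
          not blocked from \<open>c\<close>. So \<open>c\<close> was free when \<open>a\<close> was
          chosen, the old class \<open>a\<close> was at most as heavy as class \<open>c\<close>, and
          \<open>x\<close> adds at most \<open>M\<close>.\<close>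
        case True
        then have "i = a"
          using class_other[of i] x_notin[of i] by (cases "i = a") (auto simp: U'_def)
        have "c \<notin> F"
        proof
          assume "c \<in> F"
          then obtain u where u: "u \<in> S" "{x, u} \<in> E" "f u = c"
            by (auto simp: F_def)
          then have "u \<in> color_class T g c"
            using sub by (auto simp: color_class_def)
          \<comment> \<open>The order of decreasing weight enters here: the earlier neighbour
            \<open>u\<close> is at least as heavy as \<open>x\<close>.\<close>
          then have "blocked E w (color_class T g c) x"
            using u lightest[of u] by (auto simp: blocked_def insert_commute)
          then show False using True by (simp add: U'_def)
        qed
        have "sum w U' \<le> sum w (color_class T g a)"
          using fin_class class_nonneg wx \<open>i = a\<close> class_a
          by (intro sum_mono2) (auto simp: U'_def)
        also have "\<dots> \<le> M + sum w (color_class S f c)"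
          unfolding sum_a using a_min[of c] c \<open>c \<notin> F\<close> wx by (intro add_mono) auto
        finally show ?thesis using mono by linarith
      qed
    qed
  qed
qed

section \<open>From the invariants to the ratio of two classes\<close>

lemma total_weight_le:
  fixes w :: "'a \<Rightarrow> real"
  assumes G: "fin_simple_graph V E"
    and nonneg: "\<And>v. v \<in> V \<Longrightarrow> 0 \<le> w v"
    and deg: "\<And>v. v \<in> V \<Longrightarrow> vertex_degree E v \<le> d"
    and f: "f ` V \<subseteq> {1..k}"
    and lower: "\<And>i. i \<in> {1..k} \<Longrightarrow>
      sum w {v \<in> color_class V f i. \<not> blocked E w (color_class V f c) v}
        \<le> sum w (color_class V f c) + M"
  shows "sum w V \<le> (real k + real d) * sum w (color_class V f c) + real k * M"
proof -
  define A where "A = color_class V f c"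
  define U where "U = {v \<in> V. \<not> blocked E w A v}"
  have finV: "finite V"
    using G by (simp add: fin_simple_graph_def)
  \<comment> \<open>The blocked part is charged to class \<open>c\<close>; the rest is counted class
    by class, each of the \<open>k\<close> classes giving at most
    \<open>sum w A + M\<close>.\<close>
  have "sum w V = sum w {v \<in> V. blocked E w A v} + sum w U"
    unfolding U_def using finV
    by (subst sum.union_disjoint[symmetric]) (auto intro: sum.cong)
  also have "sum w {v \<in> V. blocked E w A v} \<le> real d * sum w A"
    using G nonneg deg by (rule sum_blocked_le) (auto simp: A_def color_class_def)
  also have "sum w U = (\<Sum>i\<in>{1..k}. sum w (color_class U f i))"
    using finV f by (intro sum_color_class[symmetric]) (auto simp: U_def)
  also have "\<dots> \<le> (\<Sum>i\<in>{1..k}. sum w A + M)"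
  proof (rule sum_mono)
    fix i assume "i \<in> {1..k}"
    moreover have "color_class U f i = {v \<in> color_class V f i. \<not> blocked E w A v}"
      by (auto simp: color_class_def U_def)
    ultimately show "sum w (color_class U f i) \<le> sum w A + M"
      using lower by (simp add: A_def)
  qed
  finally show ?thesis
    by (simp add: A_def algebra_simps)
qed

text \<open>Both weights are compared with \<open>W\<close>:
  \<open>(1 - \<epsilon>) * k * A \<le> W\<close> and
  \<open>(1 - \<epsilon>\<^sup>2) * W \<le> (1 + \<epsilon>) * k * L\<close>. Cancelling
  \<open>(1 + \<epsilon>) * k\<close> leaves
  \<open>(1 - \<epsilon>)\<^sup>2 * A \<le> L\<close>.\<close>

lemma class_ratio:
  fixes A L M W \<epsilon> :: real
  assumes "(k - d) * A \<le> W" "W \<le> (k + d) * L + k * M" "k * M \<le> \<epsilon>\<^sup>2 * W"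
    and "d \<le> \<epsilon> * k" "0 < k" "0 < \<epsilon>" "\<epsilon> \<le> 1 / 100" "0 \<le> A" "0 \<le> L"
  shows "A \<le> (1 + 25 * \<epsilon>) * L"
proof -
  have "(1 - \<epsilon>) * k * A \<le> (k - d) * A"
    using assms by (intro mult_right_mono) (auto simp: algebra_simps)
  then have "(1 - \<epsilon>) * k * A \<le> W" using assms by linarith
  then have "(1 - \<epsilon>\<^sup>2) * ((1 - \<epsilon>) * k * A) \<le> (1 - \<epsilon>\<^sup>2) * W"
    using assms by (intro mult_left_mono) (auto simp: power_le_one)
  also have "\<dots> \<le> (k + d) * L"
    using assms by (simp add: algebra_simps)
  also have "\<dots> \<le> ((1 + \<epsilon>) * k) * L"
    using assms by (intro mult_right_mono) (auto simp: algebra_simps)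
  finally have "((1 + \<epsilon>) * k) * ((1 - \<epsilon>)\<^sup>2 * A) \<le> ((1 + \<epsilon>) * k) * L"
    by (simp add: algebra_simps power2_eq_square)
  then have *: "(1 - \<epsilon>)\<^sup>2 * A \<le> L"
    using assms by (simp add: mult_le_cancel_left)
  \<comment> \<open>This product is the expansion of
    \<open>(1 + 25 * \<epsilon>) * (1 - \<epsilon>)\<^sup>2 - 1\<close>.\<close>
  have "0 \<le> \<epsilon> * (23 - 49 * \<epsilon> + 25 * \<epsilon>\<^sup>2)"
    using assms by (intro mult_nonneg_nonneg) (auto intro: add_nonneg_nonneg)
  then have "1 \<le> (1 + 25 * \<epsilon>) * (1 - \<epsilon>)\<^sup>2"
    by (simp add: algebra_simps power2_eq_square)
  then have "1 * A \<le> ((1 + 25 * \<epsilon>) * (1 - \<epsilon>)\<^sup>2) * A"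
    using \<open>0 \<le> A\<close> by (rule mult_right_mono)
  also have "\<dots> \<le> (1 + 25 * \<epsilon>) * L"
    using * assms unfolding mult.assoc by (intro mult_left_mono) auto
  finally show ?thesis by simp
qed

theorem theorem9:
  fixes V :: "'a set" and E :: "'a set set" and w :: "'a \<Rightarrow> real"
    and \<epsilon> :: real and k :: nat
  assumes "fin_simple_graph V E"
    and "\<forall>v\<in>V. 0 \<le> w v"
    and "0 < \<epsilon>" and "\<epsilon> \<le> 1 / 100"
    and "real k \<ge> (real (max_degree V E) + 1) / \<epsilon>"
    and "\<forall>v\<in>V. w v \<le> \<epsilon>\<^sup>2 * sum w V / ((real k)\<^sup>2 * ln (real k))"
  shows "\<exists>C. k_coloring V E k C \<and> EQ1 w (1 + 25 * \<epsilon>) k C"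
proof -
  define d where "d = max_degree V E"
  define W where "W = sum w V"
  define M where "M = \<epsilon>\<^sup>2 * W / ((real k)\<^sup>2 * ln (real k))"
  have finV: "finite V"
    using assms(1) by (simp add: fin_simple_graph_def)
  have nonneg: "\<And>v. v \<in> V \<Longrightarrow> 0 \<le> w v" and bound: "\<And>v. v \<in> V \<Longrightarrow> w v \<le> M"
    using assms by (auto simp: M_def W_def)
  have deg: "\<And>v. v \<in> V \<Longrightarrow> vertex_degree E v \<le> d"
    unfolding d_def max_degree_def using finV by (intro Max_ge) auto
  have dk: "real d + 1 \<le> \<epsilon> * k"
    using assms(3,5) by (simp add: d_def field_simps)
  have "\<epsilon> * k \<le> 1 / 100 * k"
    using assms by (intro mult_right_mono) auto
  then have k: "100 \<le> real k" and "d < k"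
    using dk by linarith+
  have W0: "0 \<le> W"
    unfolding W_def using nonneg by (rule sum_nonneg)
  have lnk: "1 \<le> ln (real k)"
    using k exp_le by (simp add: ln_ge_iff)
  have M0: "0 \<le> M"
    using W0 k lnk by (simp add: M_def)
  \<comment> \<open>The weight bound is used in the form
    \<open>k * M \<le> \<epsilon>\<^sup>2 * W\<close>, which follows since \<open>k * ln k\<close>
    is at least 1.\<close>
  have "real k * M = \<epsilon>\<^sup>2 * W / (real k * ln (real k))"
    using k by (simp add: M_def power2_eq_square)
  also have "\<dots> \<le> \<epsilon>\<^sup>2 * W / 1"
    using W0 k lnk mult_mono[of 1 "real k" 1 "ln (real k)"] by (intro divide_left_mono) auto
  finally have kM: "real k * M \<le> \<epsilon>\<^sup>2 * W" by simp
  obtain f where f: "f ` V \<subseteq> {1..k}"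
    and proper: "\<And>u v. u \<in> V \<Longrightarrow> v \<in> V \<Longrightarrow> {u, v} \<in> E \<Longrightarrow> f u \<noteq> f v"
    and upper: "\<And>i. color_class V f i \<noteq> {} \<Longrightarrow>
      \<exists>v\<in>color_class V f i. (real k - real d) * sum w (color_class V f i - {v}) \<le> W"
    and lower: "\<And>c i. c \<in> {1..k} \<Longrightarrow> i \<in> {1..k} \<Longrightarrow>
      sum w {v \<in> color_class V f i. \<not> blocked E w (color_class V f c) v}
        \<le> sum w (color_class V f c) + M"
    using greedy_coloring[where w = w, OF assms(1) nonneg bound M0 deg \<open>d < k\<close> finV order_refl]
    unfolding W_def by blast
  have "k_coloring V E k (color_class V f)"
    using f
    by (auto simp: k_coloring_def disjoint_family_on_def independent_set_def color_class_def
        dest: proper)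
  moreover have "EQ1 w (1 + 25 * \<epsilon>) k (color_class V f)"
    unfolding EQ1_def
  proof (intro ballI impI)
    fix i j assume j: "j \<in> {1..k}" and "color_class V f i \<noteq> {}"
    from upper[OF this(2)] obtain v where v: "v \<in> color_class V f i"
      and le: "(real k - real d) * sum w (color_class V f i - {v}) \<le> W" by blast
    have "W \<le> (real k + real d) * sum w (color_class V f j) + real k * M"
      unfolding W_def by (rule total_weight_le[OF assms(1) nonneg deg f lower[OF j]])
    then have "sum w (color_class V f i - {v}) \<le> (1 + 25 * \<epsilon>) * sum w (color_class V f j)"
      using le kM dk k assms(3,4)
      by (intro class_ratio[of "real k" "real d" _ W _ M])
         (auto intro!: sum_nonneg nonneg simp: color_class_def)
    then show "\<exists>v\<in>color_class V f i.
      sum w (color_class V f i - {v}) \<le> (1 + 25 * \<epsilon>) * sum w (color_class V f j)"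
      using v by blast
  qed
  ultimately show ?thesis by blast
qed

end
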